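(* Let $T$ be an $n$-tournament and let $S$ be its Seidel adjacency matrix. Then the number $\delta_T$ of diamonds in $T$ satisfies $$\delta_T \leq \frac{1}{96}n^2(n-1)(n-2).$$ Moreover, equality holds if and only if $SS^{t}=(n-1)I_n$ (that is, if and only if $S$ is a skew-conference matrix).
   Context: An $n$-tournament is a tournament (an orientation of a complete graph) with $n$ vertices; if the arc between $i$ and $j$ is directed from $i$ to $j$, we say $i$ dominates $j$. A diamond is a $4$-tournament consisting of a vertex that dominates, or is dominated by, all three vertices of a $3$-cycle. $\delta_T$ denotes the number of diamonds in $T$, i.e. the number of $4$-subsets of vertices of $T$ inducing a diamond. With respect to a labelling of the vertices by $1,\dots,n$, the adjacency matrix of $T$ is the $n\times n$ matrix $A=(a_{ij})$ with $a_{ij}=1$ if $i$ dominates $j$ and $a_{ij}=0$ otherwise, and the Seidel adjacency matrix of $T$ is $S=A-A^{t}$. $I_n$ is the identity matrix. A skew-symmetric Seidel matrix is a skew-symmetric matrix all of whose off-diagonal entries are in $\{-1,1\}$; a skew-symmetric Seidel matrix $S$ of order $n$ is called a skew-conference matrix if $SS^{t}=(n-1)I_n$. *)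

theory Defs
  imports
    "Graph_Theory.Digraph_Component"
    "Jordan_Normal_Form.Matrix"
begin

text \<open>
  The locale \<^locale>\<open>digraph\<close> supplies finiteness and excludes loops and
  parallel arcs. Adding that every two distinct vertices are joined in exactly one of the
  two directions gives an orientation of a complete graph.
\<close>

locale tournament = digraph G for G :: "('a, 'b) pre_digraph" (structure) +
  assumes exactly_one_arc:
    "\<lbrakk>u \<in> verts G; v \<in> verts G; u \<noteq> v\<rbrakk> \<Longrightarrow> (u \<rightarrow> v) \<longleftrightarrow> \<not> (v \<rightarrow> u)"

definition three_cycle :: "('a, 'b) pre_digraph \<Rightarrow> bool" where
  "three_cycle C \<longleftrightarrow> tournament C \<and> card (verts C) = 3 \<and>
     (\<exists>a b c. verts C = {a, b, c} \<and> a \<rightarrow>\<^bsub>C\<^esub> b \<and> b \<rightarrow>\<^bsub>C\<^esub> c \<and> c \<rightarrow>\<^bsub>C\<^esub> a)"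

definition diamond :: "('a, 'b) pre_digraph \<Rightarrow> bool" where
  "diamond D \<longleftrightarrow> tournament D \<and> card (verts D) = 4 \<and>
     (\<exists>v \<in> verts D. three_cycle (D \<restriction> (verts D - {v})) \<and>
        ((\<forall>u \<in> verts D - {v}. v \<rightarrow>\<^bsub>D\<^esub> u) \<or> (\<forall>u \<in> verts D - {v}. u \<rightarrow>\<^bsub>D\<^esub> v)))"

definition num_diamonds :: "('a, 'b) pre_digraph \<Rightarrow> nat" where
  "num_diamonds T = card {X. X \<subseteq> verts T \<and> card X = 4 \<and> diamond (T \<restriction> X)}"

text \<open>
  A labelling of the vertices is a bijection from the index set. Matrix indices start
  at 0, so the labels are 0, ..., n - 1 instead of 1, ..., n.
\<close>

definition vertex_labelling :: "('a, 'b) pre_digraph \<Rightarrow> nat \<Rightarrow> (nat \<Rightarrow> 'a) \<Rightarrow> bool" where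
  "vertex_labelling T n l \<longleftrightarrow> bij_betw l {0..<n} (verts T)"

definition adjacency_mat :: "('a, 'b) pre_digraph \<Rightarrow> nat \<Rightarrow> (nat \<Rightarrow> 'a) \<Rightarrow> real mat" where
  "adjacency_mat T n l = mat n n (\<lambda>(i, j). if l i \<rightarrow>\<^bsub>T\<^esub> l j then 1 else 0)"

definition seidel_mat :: "('a, 'b) pre_digraph \<Rightarrow> nat \<Rightarrow> (nat \<Rightarrow> 'a) \<Rightarrow> real mat" where
  "seidel_mat T n l = adjacency_mat T n l - transpose_mat (adjacency_mat T n l)"

definition skew_symmetric_seidel_mat :: "nat \<Rightarrow> real mat \<Rightarrow> bool" where
  "skew_symmetric_seidel_mat n S \<longleftrightarrow> S \<in> carrier_mat n n \<and> transpose_mat S = - S \<and>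
     (\<forall>i < n. \<forall>j < n. i \<noteq> j \<longrightarrow> S $$ (i, j) \<in> {-1, 1})"

definition skew_conference_mat :: "nat \<Rightarrow> real mat \<Rightarrow> bool" where
  "skew_conference_mat n S \<longleftrightarrow> skew_symmetric_seidel_mat n S \<and>
     S * transpose_mat S = (real n - 1) \<cdot>\<^sub>m 1\<^sub>m n"

end

theory Submission
  imports Defs
begin

text \<open>
  Let \<open>s\<close> be the skew sign function of the tournament, so that the entries of \<open>S\<close> are its
  values, and let \<open>E\<close> be the sum of the squares of the off-diagonal entries of \<open>S S\<^sup>t\<close>. The
  diagonal of \<open>S S\<^sup>t\<close> always consists of entries \<open>n - 1\<close>, so \<open>E \<ge> 0\<close> vanishes exactly for
  skew-conference matrices. The theorem follows from the identity
  \<open>3 E = n\<^sup>2 (n - 1) (n - 2) - 96 \<delta>\<close>, proved below as \<open>off_diagonal_energy\<close>.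

  Expanding the squares, \<open>E\<close> is the sum of \<open>s a c * s b c * s a d * s b d\<close> over ordered pairs
  \<open>a \<noteq> b\<close> and arbitrary \<open>c\<close>, \<open>d\<close>. The terms with \<open>c = d\<close> contribute \<open>n (n - 1) (n - 2)\<close>. In
  the others all four vertices may be taken distinct, and the term is the product of the signs
  along the 4-cycle \<open>a c b d\<close>. Permuting the names of the vertices, three times the sum of
  these terms is the sum, over ordered quadruples, of the total of all three 4-cycles on the
  quadruple. This total sees diamonds: it is \<open>-3\<close> on a diamond and \<open>1\<close> on any other
  4-tournament (\<open>sum_four_cycle_signs\<close>). Each 4-set carries 24 ordered quadruples, so the sum
  is \<open>n (n - 1) (n - 2) (n - 3) - 4 * 24 \<delta>\<close>, which gives the identity.
\<close>

section \<open>Diamonds in terms of arcs\<close>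

context tournament
begin

abbreviation beats :: "'a \<Rightarrow> 'a \<Rightarrow> bool" (infix \<open>\<leadsto>\<close> 50) where
  "u \<leadsto> v \<equiv> dominates G u v"

lemma dominates_restrict:
  "u \<rightarrow>\<^bsub>G \<restriction> X\<^esub> v \<longleftrightarrow> u \<in> X \<and> v \<in> X \<and> u \<leadsto> v"
  by (auto simp: arcs_ends_conv induce_subgraph_def)

lemma no_loop: "\<not> u \<leadsto> u"
  using adj_not_same by blast

lemma tournament_restrict:
  assumes "X \<subseteq> verts G"
  shows "tournament (G \<restriction> X)"
proof -
  have "digraph (G \<restriction> X)"
    using assms by (rule digraphI_induced[OF induced_induce])
  then show ?thesis
    unfolding tournament_def tournament_axioms_def
    using assms exactly_one_arc by (auto simp: dominates_restrict)
qed

lemma three_cycle_restrict_iff: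
  assumes "{a, b, c} \<subseteq> verts G" "distinct [a, b, c]"
  shows "three_cycle (G \<restriction> {a, b, c}) \<longleftrightarrow>
    (a \<leadsto> b \<and> b \<leadsto> c \<and> c \<leadsto> a) \<or> (b \<leadsto> a \<and> c \<leadsto> b \<and> a \<leadsto> c)" (is "?L \<longleftrightarrow> ?R")
proof
  assume ?L
  then obtain x y z where xyz: "{a, b, c} = {x, y, z}" and
    dom: "x \<leadsto> y" "y \<leadsto> z" "z \<leadsto> x"
    unfolding three_cycle_def dominates_restrict induce_subgraph_verts by blast
  have "x \<noteq> y" "y \<noteq> z" "z \<noteq> x"
    using dom no_loop by auto
  moreover have "x \<in> {a, b, c}" "y \<in> {a, b, c}" "z \<in> {a, b, c}"
    unfolding xyz by simp_all
  ultimately show ?R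
    using dom by (elim insertE emptyE) simp_all
next
  assume R: ?R
  have "\<exists>x y z. {a, b, c} = {x, y, z} \<and> x \<rightarrow>\<^bsub>G \<restriction> {a, b, c}\<^esub> y \<and>
      y \<rightarrow>\<^bsub>G \<restriction> {a, b, c}\<^esub> z \<and> z \<rightarrow>\<^bsub>G \<restriction> {a, b, c}\<^esub> x"
    using R
  proof
    assume "a \<leadsto> b \<and> b \<leadsto> c \<and> c \<leadsto> a"
    then show ?thesis by (intro exI[of _ a] exI[of _ b] exI[of _ c]) (simp add: dominates_restrict)
  next
    assume "b \<leadsto> a \<and> c \<leadsto> b \<and> a \<leadsto> c"
    then show ?thesis
      by (intro exI[of _ a] exI[of _ c] exI[of _ b]) (auto simp add: dominates_restrict)
  qed
  then show ?L
    unfolding three_cycle_def using assms tournament_restrict by simp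
qed

text \<open>
  The four disjuncts correspond to the choice of the apex: removing it from an induced
  subgraph on four vertices leaves the induced subgraph on the other three.
\<close>

lemma diamond_restrict_iff:
  assumes "{a, b, c, d} \<subseteq> verts G" "distinct [a, b, c, d]"
  shows "diamond (G \<restriction> {a, b, c, d}) \<longleftrightarrow>
    (three_cycle (G \<restriction> {b, c, d}) \<and> ((a \<leadsto> b \<and> a \<leadsto> c \<and> a \<leadsto> d) \<or> (b \<leadsto> a \<and> c \<leadsto> a \<and> d \<leadsto> a))) \<or>
    (three_cycle (G \<restriction> {a, c, d}) \<and> ((b \<leadsto> a \<and> b \<leadsto> c \<and> b \<leadsto> d) \<or> (a \<leadsto> b \<and> c \<leadsto> b \<and> d \<leadsto> b))) \<or>
    (three_cycle (G \<restriction> {a, b, d}) \<and> ((c \<leadsto> a \<and> c \<leadsto> b \<and> c \<leadsto> d) \<or> (a \<leadsto> c \<and> b \<leadsto> c \<and> d \<leadsto> c))) \<or>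
    (three_cycle (G \<restriction> {a, b, c}) \<and> ((d \<leadsto> a \<and> d \<leadsto> b \<and> d \<leadsto> c) \<or> (a \<leadsto> d \<and> b \<leadsto> d \<and> c \<leadsto> d)))"
proof -
  let ?X = "{a, b, c, d}"
  have restrict_twice: "(G \<restriction> X) \<restriction> Y = G \<restriction> Y" if "Y \<subseteq> X" for X Y
    using that by (auto simp: induce_subgraph_def)
  have rest: "?X - {a} = {b, c, d}" "?X - {b} = {a, c, d}" "?X - {c} = {a, b, d}" "?X - {d} = {a, b, c}"
    using assms(2) by auto
  have cone: "(three_cycle ((G \<restriction> ?X) \<restriction> (?X - {v})) \<and>
      ((\<forall>u\<in>?X - {v}. v \<rightarrow>\<^bsub>G \<restriction> ?X\<^esub> u) \<or> (\<forall>u\<in>?X - {v}. u \<rightarrow>\<^bsub>G \<restriction> ?X\<^esub> v))) \<longleftrightarrow>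
    three_cycle (G \<restriction> (?X - {v})) \<and>
      ((\<forall>u\<in>?X - {v}. v \<leadsto> u) \<or> (\<forall>u\<in>?X - {v}. u \<leadsto> v))" if "v \<in> ?X" for v
    using that unfolding restrict_twice[OF Diff_subset] dominates_restrict by blast
  have "card ?X = 4"
    using assms(2) by simp
  then have "diamond (G \<restriction> ?X) \<longleftrightarrow> (\<exists>v\<in>?X. three_cycle (G \<restriction> (?X - {v})) \<and>
      ((\<forall>u\<in>?X - {v}. v \<leadsto> u) \<or> (\<forall>u\<in>?X - {v}. u \<leadsto> v)))"
    unfolding diamond_def induce_subgraph_verts
    using tournament_restrict[OF assms(1)] cone by blast
  then show ?thesis
    unfolding bex_simps rest ball_simps by simp
qed

end

definition arc_sign :: "('a, 'b) pre_digraph \<Rightarrow> 'a \<Rightarrow> 'a \<Rightarrow> real" where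
  "arc_sign T u v = of_bool (u \<rightarrow>\<^bsub>T\<^esub> v) - of_bool (v \<rightarrow>\<^bsub>T\<^esub> u)"

lemma (in tournament) arc_sign_self: "arc_sign G u u = 0"
  by (simp add: arc_sign_def)

lemma (in tournament) arc_sign_square:
  assumes "u \<in> verts G" "v \<in> verts G" "u \<noteq> v"
  shows "(arc_sign G u v)\<^sup>2 = 1"
  using exactly_one_arc[OF assms] by (simp add: arc_sign_def)

text \<open>
  The three summands are the sign products along the 4-cycles \<open>a c b d\<close>, \<open>a b c d\<close> and
  \<open>a c d b\<close>: each takes two of its four arcs against the direction of travel, and these two
  sign changes cancel. The total depends only on the orientations of the six edges, and the
  claim is checked on all 64 combinations.
\<close>

lemma (in tournament) sum_four_cycle_signs:
  assumes V: "{a, b, c, d} \<subseteq> verts G" and dist: "distinct [a, b, c, d]"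
  defines "s \<equiv> arc_sign G"
  shows "s a c * s b c * s a d * s b d + s a b * s c b * s a d * s c d + s a c * s d c * s a b * s d b
    = 1 - 4 * of_bool (diamond (G \<restriction> {a, b, c, d}))"
proof -
  have opp: "b \<leadsto> a \<longleftrightarrow> \<not> a \<leadsto> b" "c \<leadsto> a \<longleftrightarrow> \<not> a \<leadsto> c" "d \<leadsto> a \<longleftrightarrow> \<not> a \<leadsto> d"
    "c \<leadsto> b \<longleftrightarrow> \<not> b \<leadsto> c" "d \<leadsto> b \<longleftrightarrow> \<not> b \<leadsto> d" "d \<leadsto> c \<longleftrightarrow> \<not> c \<leadsto> d"
    by (rule exactly_one_arc; use V dist in auto)+
  have sub: "{b, c, d} \<subseteq> verts G" "distinct [b, c, d]" "{a, c, d} \<subseteq> verts G" "distinct [a, c, d]"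
    "{a, b, d} \<subseteq> verts G" "distinct [a, b, d]" "{a, b, c} \<subseteq> verts G" "distinct [a, b, c]"
    using V dist by simp_all
  note cyc = three_cycle_restrict_iff[OF sub(1,2)] three_cycle_restrict_iff[OF sub(3,4)]
    three_cycle_restrict_iff[OF sub(5,6)] three_cycle_restrict_iff[OF sub(7,8)]
  have dia: "diamond (G \<restriction> {a, b, c, d}) \<longleftrightarrow>
    (((b \<leadsto> c \<and> c \<leadsto> d \<and> \<not> b \<leadsto> d) \<or> (\<not> b \<leadsto> c \<and> \<not> c \<leadsto> d \<and> b \<leadsto> d)) \<and>
       ((a \<leadsto> b \<and> a \<leadsto> c \<and> a \<leadsto> d) \<or> (\<not> a \<leadsto> b \<and> \<not> a \<leadsto> c \<and> \<not> a \<leadsto> d))) \<or>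
    (((a \<leadsto> c \<and> c \<leadsto> d \<and> \<not> a \<leadsto> d) \<or> (\<not> a \<leadsto> c \<and> \<not> c \<leadsto> d \<and> a \<leadsto> d)) \<and>
       ((\<not> a \<leadsto> b \<and> b \<leadsto> c \<and> b \<leadsto> d) \<or> (a \<leadsto> b \<and> \<not> b \<leadsto> c \<and> \<not> b \<leadsto> d))) \<or>
    (((a \<leadsto> b \<and> b \<leadsto> d \<and> \<not> a \<leadsto> d) \<or> (\<not> a \<leadsto> b \<and> \<not> b \<leadsto> d \<and> a \<leadsto> d)) \<and>
       ((\<not> a \<leadsto> c \<and> \<not> b \<leadsto> c \<and> c \<leadsto> d) \<or> (a \<leadsto> c \<and> b \<leadsto> c \<and> \<not> c \<leadsto> d))) \<or>
    (((a \<leadsto> b \<and> b \<leadsto> c \<and> \<not> a \<leadsto> c) \<or> (\<not> a \<leadsto> b \<and> \<not> b \<leadsto> c \<and> a \<leadsto> c)) \<and>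
       ((\<not> a \<leadsto> d \<and> \<not> b \<leadsto> d \<and> \<not> c \<leadsto> d) \<or> (a \<leadsto> d \<and> b \<leadsto> d \<and> c \<leadsto> d)))"
    unfolding diamond_restrict_iff[OF V dist] cyc opp by blast
  show ?thesis
    unfolding s_def arc_sign_def dia opp
    by (cases "a \<leadsto> b"; cases "a \<leadsto> c"; cases "a \<leadsto> d"; cases "b \<leadsto> c"; cases "b \<leadsto> d"; cases "c \<leadsto> d")
      simp_all
qed

section \<open>Ordered quadruples of distinct elements\<close>

definition distinct_quadruples :: "'a set \<Rightarrow> ('a \<times> 'a \<times> 'a \<times> 'a) set" where
  "distinct_quadruples V = {(a, b, c, d). {a, b, c, d} \<subseteq> V \<and> distinct [a, b, c, d]}"

lemma finite_distinct_quadruples: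
  assumes "finite V"
  shows "finite (distinct_quadruples V)"
  by (rule finite_subset[of _ "V \<times> V \<times> V \<times> V"]) (use assms in \<open>auto simp: distinct_quadruples_def\<close>)

text \<open>
  The grouping of the iterated sum matches the expansion of a square: the pair \<open>a\<close>, \<open>b\<close> is
  removed first, and the diagonal \<open>c = d\<close> afterwards.
\<close>

lemma sum_distinct_quadruples:
  fixes f :: "'a \<Rightarrow> 'a \<Rightarrow> 'a \<Rightarrow> 'a \<Rightarrow> real"
  assumes "finite V"
  shows "(\<Sum>(a, b, c, d)\<in>distinct_quadruples V. f a b c d) =
    (\<Sum>a\<in>V. \<Sum>b\<in>V-{a}. \<Sum>c\<in>V-{a,b}. \<Sum>d\<in>V-{a,b}-{c}. f a b c d)"
proof -
  have "distinct_quadruples V = (SIGMA a:V. SIGMA b:V-{a}. SIGMA c:V-{a,b}. V-{a,b}-{c})"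
    by (auto simp: distinct_quadruples_def)
  then show ?thesis
    using assms by (simp add: sum.Sigma)
qed

lemma real_card_remove:
  assumes "x \<in> A" "finite A"
  shows "real (card (A - {x})) = real (card A) - 1"
  using assms card_gt_0_iff[of A] by (auto simp: of_nat_diff Suc_le_eq)

lemma card_distinct_quadruples:
  assumes "finite V"
  defines "n \<equiv> real (card V)"
  shows "real (card (distinct_quadruples V)) = n * (n - 1) * (n - 2) * (n - 3)"
proof -
  have two: "V - {a, b} = V - {a} - {b}" for a b
    by auto
  have "real (card (distinct_quadruples V)) = (\<Sum>(a, b, c, d)\<in>distinct_quadruples V. 1)"
    by (simp add: case_prod_unfold)
  also have "\<dots> = (\<Sum>a\<in>V. \<Sum>b\<in>V-{a}. \<Sum>c\<in>V-{a,b}. \<Sum>d\<in>V-{a,b}-{c}. 1)"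
    using assms(1) by (rule sum_distinct_quadruples)
  also have "\<dots> = n * (n - 1) * (n - 2) * (n - 3)"
    using assms(1) by (simp add: two real_card_remove n_def del: card_Diff_insert card_Diff_singleton)
  finally show ?thesis .
qed

text \<open>
  Quadruples are grouped by their underlying set; the fibre over a 4-set \<open>X\<close> consists of the
  distinct quadruples in \<open>X\<close>, of which there are \<open>4 * 3 * 2 * 1\<close>.
\<close>

lemma sum_distinct_quadruples_set:
  fixes g :: "'a set \<Rightarrow> real"
  assumes "finite V"
  shows "(\<Sum>(a, b, c, d)\<in>distinct_quadruples V. g {a, b, c, d}) =
    24 * (\<Sum>X | X \<subseteq> V \<and> card X = 4. g X)"
proof -
  let ?Q = "distinct_quadruples V" and ?P = "{X. X \<subseteq> V \<and> card X = 4}"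
  let ?set = "\<lambda>(a, b, c, d). {a, b, c, d}"
  have fibre: "{q \<in> ?Q. ?set q = X} = distinct_quadruples X" if "X \<in> ?P" for X
  proof -
    have fin: "finite X" using that by (auto intro: card_ge_0_finite)
    have "{a, b, c, d} = X" if "{a, b, c, d} \<subseteq> X" "distinct [a, b, c, d]" for a b c d
      using that \<open>X \<in> ?P\<close> by (intro card_subset_eq[OF fin]) auto
    then show ?thesis
      using that by (auto simp: distinct_quadruples_def)
  qed
  have "(\<Sum>(a, b, c, d)\<in>?Q. g {a, b, c, d}) = (\<Sum>q\<in>?Q. g (?set q))"
    by (simp add: case_prod_unfold)
  also have "\<dots> = (\<Sum>X\<in>?P. \<Sum>q\<in>{q \<in> ?Q. ?set q = X}. g (?set q))"
    by (rule sum.group[OF finite_distinct_quadruples, symmetric])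
      (use assms in \<open>auto simp: distinct_quadruples_def\<close>)
  also have "\<dots> = (\<Sum>X\<in>?P. \<Sum>q\<in>distinct_quadruples X. g X)"
  proof (intro sum.cong refl)
    show "{q \<in> ?Q. ?set q = X} = distinct_quadruples X" if "X \<in> ?P" for X
      using that by (rule fibre)
    show "g (?set q) = g X" if "X \<in> ?P" "q \<in> distinct_quadruples X" for X q
    proof -
      have "q \<in> {q \<in> ?Q. ?set q = X}"
        unfolding fibre[OF that(1)] by (rule that(2))
      then have "?set q = X"
        unfolding mem_Collect_eq by (rule conjunct2)
      then show ?thesis
        by (rule arg_cong)
    qed
  qed
  also have "\<dots> = (\<Sum>X\<in>?P. 24 * g X)"
  proof (rule sum.cong[OF refl])
    fix X assume "X \<in> ?P"
    then have "finite X" "card X = 4" by (auto intro: card_ge_0_finite)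
    then show "(\<Sum>q\<in>distinct_quadruples X. g X) = 24 * g X"
      using card_distinct_quadruples[of X] by simp
  qed
  finally show ?thesis by (simp add: sum_distrib_left)
qed

section \<open>The sum of squares of the off-diagonal entries\<close>

text \<open>
  In the expansion of a square, indices \<open>c \<in> {a, b}\<close> drop out because the diagonal of the sign
  function is zero, and the terms with \<open>c = d\<close> are squares of signs, hence equal to 1.
\<close>

lemma (in tournament) sum_row_products_squared:
  defines "s \<equiv> arc_sign G" and "V \<equiv> verts G"
  shows "(\<Sum>a\<in>V. \<Sum>b\<in>V-{a}. (\<Sum>c\<in>V. s a c * s b c)\<^sup>2) =
    real (card V) * (real (card V) - 1) * (real (card V) - 2) +
    (\<Sum>(a, b, c, d)\<in>distinct_quadruples V. s a c * s b c * s a d * s b d)"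
proof -
  have fin: "finite V" by (simp add: V_def)
  have inner: "(\<Sum>c\<in>V. s a c * s b c)\<^sup>2 = real (card V) - 2 +
    (\<Sum>c\<in>V-{a,b}. \<Sum>d\<in>V-{a,b}-{c}. s a c * s b c * s a d * s b d)"
    if ab: "a \<in> V" "b \<in> V - {a}" for a b
  proof -
    let ?W = "V - {a, b}" and ?g = "\<lambda>c. s a c * s b c"
    have "(\<Sum>c\<in>V. ?g c) = (\<Sum>c\<in>?W. ?g c)"
      by (rule sum.mono_neutral_right) (auto simp: fin s_def arc_sign_self)
    then have "(\<Sum>c\<in>V. ?g c)\<^sup>2 = (\<Sum>c\<in>?W. \<Sum>d\<in>?W. ?g c * ?g d)"
      by (simp add: power2_eq_square sum_product)
    also have "\<dots> = (\<Sum>c\<in>?W. ?g c * ?g c + (\<Sum>d\<in>?W-{c}. ?g c * ?g d))"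
      by (rule sum.cong[OF refl], rule sum.remove) (use fin in auto)
    also have "\<dots> = (\<Sum>c\<in>?W. 1 + (\<Sum>d\<in>?W-{c}. ?g c * ?g d))"
    proof (rule sum.cong[OF refl])
      fix c assume "c \<in> ?W"
      then have "(s a c)\<^sup>2 = 1" "(s b c)\<^sup>2 = 1"
        using ab by (auto simp: s_def V_def intro!: arc_sign_square)
      then have "?g c * ?g c = 1"
        by (metis mult.assoc mult.left_commute mult_1 power2_eq_square)
      then show "?g c * ?g c + (\<Sum>d\<in>?W-{c}. ?g c * ?g d) = 1 + (\<Sum>d\<in>?W-{c}. ?g c * ?g d)"
        by simp
    qed
    also have "\<dots> = real (card ?W) + (\<Sum>c\<in>?W. \<Sum>d\<in>?W-{c}. s a c * s b c * s a d * s b d)"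
      by (simp add: sum.distrib mult.assoc)
    also have "real (card ?W) = real (card V) - 2"
    proof -
      have "?W = V - {a} - {b}" by auto
      then show ?thesis
        using ab fin by (simp add: real_card_remove del: card_Diff_insert card_Diff_singleton)
    qed
    finally show ?thesis .
  qed
  have "(\<Sum>a\<in>V. \<Sum>b\<in>V-{a}. (\<Sum>c\<in>V. s a c * s b c)\<^sup>2) =
    (\<Sum>a\<in>V. \<Sum>b\<in>V-{a}. real (card V) - 2 +
      (\<Sum>c\<in>V-{a,b}. \<Sum>d\<in>V-{a,b}-{c}. s a c * s b c * s a d * s b d))"
    using inner by (intro sum.cong) auto
  also have "\<dots> = real (card V) * (real (card V) - 1) * (real (card V) - 2) +
    (\<Sum>(a, b, c, d)\<in>distinct_quadruples V. s a c * s b c * s a d * s b d)"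
    by (simp add: sum.distrib real_card_remove fin sum_distinct_quadruples del: card_Diff_insert card_Diff_singleton)
  finally show ?thesis .
qed

text \<open>
  A single 4-cycle does not detect whether its vertices form a diamond; the total over the
  three 4-cycles does, and reindexing by transpositions replaces the one by the other.
\<close>

lemma (in tournament) sum_quadruple_products:
  defines "s \<equiv> arc_sign G" and "V \<equiv> verts G" and "n \<equiv> real (card (verts G))"
  shows "3 * (\<Sum>(a, b, c, d)\<in>distinct_quadruples V. s a c * s b c * s a d * s b d) =
    n * (n - 1) * (n - 2) * (n - 3) - 96 * real (num_diamonds G)"
proof -
  let ?Q = "distinct_quadruples V"
  have fin: "finite V" by (simp add: V_def)
  have swap_bc: "(\<Sum>(a, b, c, d)\<in>?Q. s a c * s b c * s a d * s b d) =
      (\<Sum>(a, b, c, d)\<in>?Q. s a b * s c b * s a d * s c d)"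
    by (rule sum.reindex_bij_witness[where i = "\<lambda>(a, b, c, d). (a, c, b, d)" and j = "\<lambda>(a, b, c, d). (a, c, b, d)"])
      (auto simp: distinct_quadruples_def)
  have swap_bd: "(\<Sum>(a, b, c, d)\<in>?Q. s a c * s b c * s a d * s b d) =
      (\<Sum>(a, b, c, d)\<in>?Q. s a c * s d c * s a b * s d b)"
    by (rule sum.reindex_bij_witness[where i = "\<lambda>(a, b, c, d). (a, d, c, b)" and j = "\<lambda>(a, b, c, d). (a, d, c, b)"])
      (auto simp: distinct_quadruples_def)
  have "3 * (\<Sum>(a, b, c, d)\<in>?Q. s a c * s b c * s a d * s b d) =
      (\<Sum>(a, b, c, d)\<in>?Q. s a c * s b c * s a d * s b d) +
      (\<Sum>(a, b, c, d)\<in>?Q. s a b * s c b * s a d * s c d) +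
      (\<Sum>(a, b, c, d)\<in>?Q. s a c * s d c * s a b * s d b)"
    using swap_bc swap_bd by linarith
  also have "\<dots> = (\<Sum>(a, b, c, d)\<in>?Q. s a c * s b c * s a d * s b d +
      s a b * s c b * s a d * s c d + s a c * s d c * s a b * s d b)"
    by (simp add: case_prod_unfold sum.distrib)
  also have "\<dots> = (\<Sum>(a, b, c, d)\<in>?Q. 1 - 4 * of_bool (diamond (G \<restriction> {a, b, c, d})))"
    unfolding s_def
    by (rule sum.cong[OF refl])
      (clarsimp simp: distinct_quadruples_def V_def sum_four_cycle_signs)
  also have "\<dots> = real (card ?Q) -
      4 * (\<Sum>(a, b, c, d)\<in>?Q. of_bool (diamond (G \<restriction> {a, b, c, d})))"
    by (simp add: case_prod_unfold sum_subtractf sum_distrib_left)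
  also have "(\<Sum>(a, b, c, d)\<in>?Q. of_bool (diamond (G \<restriction> {a, b, c, d})) :: real) =
      24 * (\<Sum>X | X \<subseteq> V \<and> card X = 4. of_bool (diamond (G \<restriction> X)))"
    by (rule sum_distinct_quadruples_set[OF fin])
  also have "(\<Sum>X | X \<subseteq> V \<and> card X = 4. of_bool (diamond (G \<restriction> X)) :: real) = real (num_diamonds G)"
    using fin by (simp add: num_diamonds_def V_def sum.If_cases of_bool_def Int_def conj_assoc)
  finally show ?thesis
    using card_distinct_quadruples[OF fin] by (simp add: n_def V_def)
qed

lemma (in tournament) off_diagonal_energy:
  defines "s \<equiv> arc_sign G" and "V \<equiv> verts G" and "n \<equiv> real (card (verts G))"
  shows "3 * (\<Sum>a\<in>V. \<Sum>b\<in>V-{a}. (\<Sum>c\<in>V. s a c * s b c)\<^sup>2) =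
    n\<^sup>2 * (n - 1) * (n - 2) - 96 * real (num_diamonds G)"
  using sum_row_products_squared sum_quadruple_products
  unfolding s_def V_def n_def by (simp add: algebra_simps power2_eq_square)

section \<open>The bound and its equality case\<close>

theorem mainTheorem1:
  fixes T :: "('a, 'b) pre_digraph" and n :: nat and l :: "nat \<Rightarrow> 'a" and S :: "real mat"
  assumes "tournament T" and "card (verts T) = n"
    and "vertex_labelling T n l" and "S = seidel_mat T n l"
  shows "real (num_diamonds T) \<le> 1 / 96 * (real n)^2 * (real n - 1) * (real n - 2) \<and>
    (real (num_diamonds T) = 1 / 96 * (real n)^2 * (real n - 1) * (real n - 2)
       \<longleftrightarrow> S * transpose_mat S = (real n - 1) \<cdot>\<^sub>m 1\<^sub>m n) \<and>
    (S * transpose_mat S = (real n - 1) \<cdot>\<^sub>m 1\<^sub>m n \<longleftrightarrow> skew_conference_mat n S)"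
proof -
  interpret tournament T by fact
  let ?V = "verts T" and ?s = "arc_sign T"
  let ?p = "\<lambda>a b. \<Sum>c\<in>?V. ?s a c * ?s b c"
  let ?E = "\<Sum>a\<in>?V. \<Sum>b\<in>?V-{a}. (?p a b)\<^sup>2"
  have bij: "bij_betw l {0..<n} ?V"
    using assms(3) by (simp add: vertex_labelling_def)
  have lV: "l i \<in> ?V" if "i < n" for i
    using bij that by (auto simp: bij_betw_def)
  have l_eq: "l i = l j \<longleftrightarrow> i = j" if "i < n" "j < n" for i j
    using bij that by (auto simp: bij_betw_def inj_on_def)
  have V_eq: "?V = l ` {0..<n}"
    using bij by (simp add: bij_betw_def)
  have S_carrier: "S \<in> carrier_mat n n"
    by (intro carrier_matI) (simp_all add: assms(4) seidel_mat_def adjacency_mat_def)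
  have S_entry: "S $$ (i, j) = ?s (l i) (l j)" if "i < n" "j < n" for i j
    using that by (simp add: assms(4) seidel_mat_def adjacency_mat_def arc_sign_def)
  have prod_entry: "(S * transpose_mat S) $$ (i, j) = ?p (l i) (l j)" if "i < n" "j < n" for i j
  proof -
    have "(S * transpose_mat S) $$ (i, j) = (\<Sum>k = 0..<n. ?s (l i) (l k) * ?s (l j) (l k))"
      using that S_carrier by (simp add: scalar_prod_def S_entry)
    also have "\<dots> = ?p (l i) (l j)"
      using sum.reindex_bij_betw[OF bij, of "\<lambda>c. ?s (l i) c * ?s (l j) c"] by simp
    finally show ?thesis .
  qed
  have diag: "?p a a = real n - 1" if "a \<in> ?V" for a
  proof -
    have "?p a a = (\<Sum>c\<in>?V-{a}. ?s a c * ?s a c)"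
      by (rule sum.mono_neutral_right) (auto simp: arc_sign_self)
    also have "\<dots> = (\<Sum>c\<in>?V-{a}. 1)"
      by (rule sum.cong) (use that arc_sign_square in \<open>auto simp: power2_eq_square\<close>)
    also have "\<dots> = real n - 1"
      using that assms(2) by (simp add: real_card_remove del: card_Diff_insert card_Diff_singleton)
    finally show ?thesis .
  qed
  have conf_iff: "S * transpose_mat S = (real n - 1) \<cdot>\<^sub>m 1\<^sub>m n \<longleftrightarrow>
      (\<forall>a\<in>?V. \<forall>b\<in>?V-{a}. ?p a b = 0)" (is "?C \<longleftrightarrow> ?Z")
  proof
    assume C: ?C
    show ?Z
    proof (intro ballI)
      fix a b assume "a \<in> ?V" "b \<in> ?V - {a}"
      then obtain i j where ij: "a = l i" "b = l j" "i < n" "j < n" "l i \<noteq> l j"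
        unfolding V_eq by auto
      then have "i \<noteq> j"
        by auto
      with ij show "?p a b = 0"
        using prod_entry[of i j] C by simp
    qed
  next
    assume Z: ?Z
    show ?C
    proof (rule eq_matI)
      fix i j assume "i < dim_row ((real n - 1) \<cdot>\<^sub>m 1\<^sub>m n)" "j < dim_col ((real n - 1) \<cdot>\<^sub>m (1\<^sub>m n :: real mat))"
      then have ij: "i < n" "j < n" by auto
      show "(S * transpose_mat S) $$ (i, j) = ((real n - 1) \<cdot>\<^sub>m 1\<^sub>m n) $$ (i, j)"
        using ij Z diag lV l_eq by (cases "i = j") (auto simp: prod_entry)
    qed (use S_carrier in auto)
  qed
  have E_nonneg: "0 \<le> ?E" by (intro sum_nonneg) auto
  have E_zero: "?E = 0 \<longleftrightarrow> ?Z"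
    by (simp add: sum_nonneg_eq_0_iff sum_nonneg)
  have key: "3 * ?E = (real n)\<^sup>2 * (real n - 1) * (real n - 2) - 96 * real (num_diamonds T)"
    using off_diagonal_energy by (simp add: assms(2))
  have seidel: "skew_symmetric_seidel_mat n S"
    unfolding skew_symmetric_seidel_mat_def
  proof (intro conjI allI impI)
    show "transpose_mat S = - S"
      using S_carrier by (intro eq_matI) (auto simp: S_entry arc_sign_def)
    show "S $$ (i, j) \<in> {-1, 1}" if "i < n" "j < n" "i \<noteq> j" for i j
      using arc_sign_square[OF lV lV, of i j] that l_eq by (auto simp: S_entry power2_eq_1_iff)
  qed (rule S_carrier)
  have "real (num_diamonds T) \<le> 1 / 96 * (real n)^2 * (real n - 1) * (real n - 2)"
    using key E_nonneg by simp
  moreover have "real (num_diamonds T) = 1 / 96 * (real n)^2 * (real n - 1) * (real n - 2) \<longleftrightarrow> ?E = 0"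
    using key by auto
  ultimately show ?thesis
    using conf_iff E_zero seidel by (simp add: skew_conference_mat_def)
qed

end
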